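(* Let $H$ be a separable real Hilbert space, let $A$ be a nonnegative self-adjoint (possibly unbounded) linear operator on $H$ with dense domain, let $\gamma\ge 1$, and let $(u_0,u_1)\in D(A)\times D(A^{1/2})$ with $A^{1/2}u_0\neq 0$. Let $\varepsilon_0>0$, $u(t)$, $u_\varepsilon(t)$ and $\rho_\varepsilon(t)=u_\varepsilon(t)-u(t)$ (for $\varepsilon\in(0,\varepsilon_0)$) be as defined in the context. Assume that $u_0$ and $u_1$ are eigenvectors of $A$ with respect to the eigenvalues $\mu$ and $\nu$, respectively, and let $\delta:=\nu/\mu$. Assume also that either $\nu<\mu$, or $\nu=\mu$ and $u_0$ and $u_1$ are orthogonal. Then there exist $\varepsilon_1\in(0,\varepsilon_0)$ and $C>0$ (independent of $\varepsilon$) such that for every $\varepsilon\in(0,\varepsilon_1)$ $$\sup_{t\ge0}\left\{(1+t)^{\delta/\gamma}|\rho_\varepsilon(t)|^2\right\}\ge C\varepsilon^2.$$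
   Context: $|\cdot|$ and $\langle\cdot,\cdot\rangle$ denote the norm and scalar product of $H$; $A^\alpha$ ($\alpha\ge0$) denotes the power of $A$, with domain $D(A^\alpha)$. Eigenvectors are nonzero. Parabolic problem: $u(t)$ is the unique global solution of $u'(t)+|A^{1/2}u(t)|^{2\gamma}Au(t)=0$ for $t\ge 0$, $u(0)=u_0$ (it is known to exist for every $u_0\in D(A)$). Hyperbolic problem: $u_\varepsilon(t)$ is the unique global solution of $\varepsilon u_\varepsilon''(t)+u_\varepsilon'(t)+|A^{1/2}u_\varepsilon(t)|^{2\gamma}Au_\varepsilon(t)=0$ for $t\ge0$, $u_\varepsilon(0)=u_0$, $u_\varepsilon'(0)=u_1$. For $(u_0,u_1)\in D(A)\times D(A^{1/2})$ with $A^{1/2}u_0\ne0$ it is known that such a solution exists at least for every $\varepsilon\in(0,\varepsilon_0)$ for some $\varepsilon_0>0$; such an $\varepsilon_0$ is fixed. Solutions are understood in the usual strong sense: $u\in C^1([0,+\infty);H)\cap C^0([0,+\infty);D(A))$ and $u_\varepsilon\in C^2([0,+\infty);H)\cap C^1([0,+\infty);D(A^{1/2}))\cap C^0([0,+\infty);D(A))$. *)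

theory Defs
  imports "HOL-Analysis.Analysis"
begin

text \<open>
  An unbounded operator is given by its domain \<open>D\<close> and a function \<open>A\<close>; the values of \<open>A\<close>
  outside \<open>D\<close> are irrelevant and never used.
\<close>

definition operator_on :: "'h::real_inner set \<Rightarrow> ('h \<Rightarrow> 'h) \<Rightarrow> bool" where
  "operator_on D A \<longleftrightarrow> subspace D \<and>
     (\<forall>x\<in>D. \<forall>y\<in>D. A (x + y) = A x + A y) \<and> (\<forall>c. \<forall>x\<in>D. A (c *\<^sub>R x) = c *\<^sub>R A x)"

definition graph_on :: "'h set \<Rightarrow> ('h \<Rightarrow> 'h) \<Rightarrow> ('h \<times> 'h) set" where
  "graph_on D A = {(x, A x) | x. x \<in> D}"

text \<open>
  The graph of the adjoint: \<open>y\<close> is in the domain of \<open>A*\<close> with \<open>A* y = z\<close> iff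
  \<open>\<langle>A x, y\<rangle> = \<langle>x, z\<rangle>\<close> for all \<open>x \<in> D\<close> (single-valued when \<open>D\<close> is dense).
\<close>

definition adjoint_graph :: "'h::real_inner set \<Rightarrow> ('h \<Rightarrow> 'h) \<Rightarrow> ('h \<times> 'h) set" where
  "adjoint_graph D A = {(y, z). \<forall>x\<in>D. A x \<bullet> y = x \<bullet> z}"

definition self_adjoint :: "'h::real_inner set \<Rightarrow> ('h \<Rightarrow> 'h) \<Rightarrow> bool" where
  "self_adjoint D A \<longleftrightarrow>
     operator_on D A \<and> closure D = UNIV \<and> adjoint_graph D A = graph_on D A"

definition nonneg_self_adjoint :: "'h::real_inner set \<Rightarrow> ('h \<Rightarrow> 'h) \<Rightarrow> bool" where
  "nonneg_self_adjoint D A \<longleftrightarrow> self_adjoint D A \<and> (\<forall>x\<in>D. 0 \<le> A x \<bullet> x)"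

text \<open>
  \<open>(DS, S)\<close> is \<open>A\<^sup>1\<^sup>/\<^sup>2\<close>: the nonnegative self-adjoint operator whose square, on its natural
  domain, is \<open>A\<close>. For nonnegative self-adjoint \<open>A\<close> on a Hilbert space it exists and is unique
  (as an operator, i.e. up to the values of \<open>S\<close> outside \<open>DS\<close>).
\<close>

definition is_sqrt_of :: "'h::real_inner set \<Rightarrow> ('h \<Rightarrow> 'h) \<Rightarrow> 'h set \<Rightarrow> ('h \<Rightarrow> 'h) \<Rightarrow> bool" where
  "is_sqrt_of DS S D A \<longleftrightarrow> nonneg_self_adjoint DS S \<and>
     D = {x \<in> DS. S x \<in> DS} \<and> (\<forall>x\<in>D. A x = S (S x))"

definition eigenvector :: "'h::real_inner set \<Rightarrow> ('h \<Rightarrow> 'h) \<Rightarrow> real \<Rightarrow> 'h \<Rightarrow> bool" where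
  "eigenvector D A \<mu> x \<longleftrightarrow> x \<in> D \<and> x \<noteq> 0 \<and> A x = \<mu> *\<^sub>R x"

text \<open>
  \<open>D(B)\<close> carries the graph norm \<open>(|x|\<^sup>2 + |B x|\<^sup>2)\<^sup>1\<^sup>/\<^sup>2\<close>, which is the norm of
  \<open>(x, B x)\<close> in \<open>H \<times> H\<close>. Hence continuity and differentiability in \<open>D(B)\<close> are those of
  \<open>t \<mapsto> (f t, B (f t))\<close>. All derivatives are one-sided at \<open>t = 0\<close>.
\<close>

definition C1_with :: "(real \<Rightarrow> 'b::real_normed_vector) \<Rightarrow> (real \<Rightarrow> 'b) \<Rightarrow> bool" where
  "C1_with f f' \<longleftrightarrow>
     (\<forall>t\<ge>0. (f has_vector_derivative f' t) (at t within {0..})) \<and> continuous_on {0..} f'"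

definition C0_in_domain :: "'h::real_inner set \<Rightarrow> ('h \<Rightarrow> 'h) \<Rightarrow> (real \<Rightarrow> 'h) \<Rightarrow> bool" where
  "C0_in_domain D B f \<longleftrightarrow> (\<forall>t\<ge>0. f t \<in> D) \<and> continuous_on {0..} (\<lambda>t. (f t, B (f t)))"

definition C1_in_domain_with ::
    "'h::real_inner set \<Rightarrow> ('h \<Rightarrow> 'h) \<Rightarrow> (real \<Rightarrow> 'h) \<Rightarrow> (real \<Rightarrow> 'h) \<Rightarrow> bool" where
  "C1_in_domain_with D B f f' \<longleftrightarrow> (\<forall>t\<ge>0. f t \<in> D \<and> f' t \<in> D) \<and>
     C1_with (\<lambda>t. (f t, B (f t))) (\<lambda>t. (f' t, B (f' t)))"

text \<open>In the two problems below \<open>S\<close>, with domain \<open>DS\<close>, stands for \<open>A\<^sup>1\<^sup>/\<^sup>2\<close>.\<close>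

definition parabolic_solution ::
    "'h::real_inner set \<Rightarrow> ('h \<Rightarrow> 'h) \<Rightarrow> ('h \<Rightarrow> 'h) \<Rightarrow> real \<Rightarrow> 'h \<Rightarrow> (real \<Rightarrow> 'h) \<Rightarrow> bool" where
  "parabolic_solution D A S \<gamma> u0 u \<longleftrightarrow>
     (\<exists>u'. C1_with u u' \<and> C0_in_domain D A u \<and>
        (\<forall>t\<ge>0. u' t + (norm (S (u t)) powr (2 * \<gamma>)) *\<^sub>R A (u t) = 0) \<and>
        u 0 = u0)"

definition hyperbolic_solution ::
    "'h::real_inner set \<Rightarrow> ('h \<Rightarrow> 'h) \<Rightarrow> 'h set \<Rightarrow> ('h \<Rightarrow> 'h) \<Rightarrow> real \<Rightarrow> 'h \<Rightarrow> 'h \<Rightarrow>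
       real \<Rightarrow> (real \<Rightarrow> 'h) \<Rightarrow> bool" where
  "hyperbolic_solution D A DS S \<gamma> u0 u1 \<epsilon> u \<longleftrightarrow>
     (\<exists>u' u''. C1_with u u' \<and> C1_with u' u'' \<and>
        C1_in_domain_with DS S u u' \<and> C0_in_domain D A u \<and>
        (\<forall>t\<ge>0. \<epsilon> *\<^sub>R u'' t + u' t + (norm (S (u t)) powr (2 * \<gamma>)) *\<^sub>R A (u t) = 0) \<and>
        u 0 = u0 \<and> u' 0 = u1)"

end

theory Submission
  imports Defs
begin

text \<open>
  Already the initial layer \<open>0 \<le> t \<le> \<epsilon>\<close> produces the lower bound. The component of \<open>u\<close> along
  \<open>u\<^sub>1\<close> vanishes identically, so that of \<open>\<rho>\<^sub>\<epsilon>\<close> is \<open>y = \<langle>u\<^sub>\<epsilon>, u\<^sub>1\<rangle>\<close>, which solves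
  \<open>\<epsilon> y'' + y' + \<nu> |A\<^sup>1\<^sup>/\<^sup>2 u\<^sub>\<epsilon>|\<^sup>2\<^sup>\<gamma> y = 0\<close> with \<open>y(0) = 0\<close> and \<open>y'(0) = |u\<^sub>1|\<^sup>2\<close>. The energy
  \<open>\<epsilon> |u\<^sub>\<epsilon>'|\<^sup>2 + |A\<^sup>1\<^sup>/\<^sup>2 u\<^sub>\<epsilon>|\<^sup>2\<^sup>\<gamma>\<^sup>+\<^sup>2 / (\<gamma> + 1)\<close> is nonincreasing, so the coefficient is bounded
  uniformly in \<open>\<epsilon>\<close>, and therefore \<open>|y|\<close> reaches the order \<open>\<epsilon>\<close> by the time \<open>\<epsilon>\<close>. The weight
  \<open>(1 + t)\<^sup>\<delta>\<^sup>/\<^sup>\<gamma>\<close> is at least 1.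
\<close>

section \<open>Calculus on the half-line and the scalar damped equation\<close>

lemma linear_lower_bound_from_derivative:
  fixes f f' :: "real \<Rightarrow> real"
  assumes "0 \<le> T"
    and deriv: "\<And>t. 0 \<le> t \<Longrightarrow> (f has_real_derivative f' t) (at t within {0..})"
    and lower: "\<And>t. 0 \<le> t \<Longrightarrow> t \<le> T \<Longrightarrow> m \<le> f' t"
  shows "f 0 + m * T \<le> f T"
proof -
  have "\<exists>x\<in>{0..T}. f T - f 0 = (\<lambda>h. f' x * h) (T - 0)"
  proof (rule mvt_very_simple)
    fix x assume "0 \<le> x" "x \<le> T"
    then show "(f has_derivative (\<lambda>h. f' x * h)) (at x within {0..T})"
      using deriv[of x] by (auto simp: has_field_derivative_def intro: has_derivative_subset)
  qed (fact assms(1))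
  then obtain x where "x \<in> {0..T}" "f T - f 0 = f' x * T" by auto
  moreover from this have "m * T \<le> f' x * T"
    using lower[of x] assms(1) by (intro mult_right_mono) auto
  ultimately show ?thesis by linarith
qed

text \<open>Needed because the energy contains a power of \<open>norm (S (u t))\<close> squared,
  which may vanish at some time. At 0 the difference quotient is \<open>y powr (a - 1)\<close>,
  which tends to 0 because \<open>1 < a\<close>.\<close>

lemma has_real_derivative_powr_within_nonneg:
  fixes a x :: real
  assumes "1 < a" "0 \<le> x"
  shows "((\<lambda>x. x powr a) has_real_derivative a * x powr (a - 1)) (at x within {0..})"
proof (cases "x = 0")
  case False
  with assms show ?thesis
    by (intro has_field_derivative_at_within[OF has_real_derivative_powr]) auto
next
  case True
  have "((\<lambda>y. y powr (a - 1)) \<longlongrightarrow> 0) (at (0::real) within {0..})"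
    using assms by (intro tendsto_eq_intros tendsto_ident_at) (auto simp: eventually_at_filter)
  moreover have "\<forall>\<^sub>F y in at (0::real) within {0..}. y powr (a - 1) = (y powr a - 0 powr a) / (y - 0)"
    unfolding eventually_at_filter by (rule always_eventually) (auto simp: powr_diff)
  ultimately have "((\<lambda>y. (y powr a - 0 powr a) / (y - 0)) \<longlongrightarrow> 0) (at (0::real) within {0..})"
    by (rule Lim_transform_eventually)
  with True assms show ?thesis
    by (simp add: has_field_derivative_iff)
qed

text \<open>The combination \<open>\<epsilon> * y' + y\<close> has derivative
  \<open>- c * y\<close>. As long as \<open>y\<close> is of size \<open>k * \<epsilon>\<close>, this
  changes the combination too little for \<open>y'\<close> to fall below \<open>b / 2\<close> before
  time \<open>\<epsilon>\<close>; but then \<open>y\<close> has already grown to the claimed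
  size.\<close>

lemma damped_oscillator_initial_layer:
  fixes y y' y'' c :: "real \<Rightarrow> real"
  assumes "0 < \<epsilon>" "0 < b" "0 \<le> B"
    and dy: "\<And>t. 0 \<le> t \<Longrightarrow> (y has_real_derivative y' t) (at t within {0..})"
    and dy': "\<And>t. 0 \<le> t \<Longrightarrow> (y' has_real_derivative y'' t) (at t within {0..})"
    and ode: "\<And>t. 0 \<le> t \<Longrightarrow> \<epsilon> * y'' t + y' t + c t * y t = 0"
    and c: "\<And>t. 0 \<le> t \<Longrightarrow> 0 \<le> c t \<and> c t \<le> B"
    and init: "y 0 = 0" "y' 0 = b"
  shows "\<exists>t\<ge>0. b / (2 * (1 + B * \<epsilon>)) * \<epsilon> \<le> \<bar>y t\<bar>"
proof (rule ccontr)
  \<comment> \<open>The value is chosen so that \<open>B * k * \<epsilon>\<close> (from the term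
    \<open>c * y\<close>) and \<open>k\<close> (from \<open>y\<close> itself), the two possible
    losses in \<open>y'\<close>, add up to exactly \<open>b / 2\<close>.\<close>
  define k where "k = b / (2 * (1 + B * \<epsilon>))"
  have pos: "0 < 1 + B * \<epsilon>" using assms by (simp add: add_pos_nonneg)
  then have k: "k * (1 + B * \<epsilon>) = b / 2" "0 < k"
    unfolding k_def using assms by (auto simp: field_simps)
  assume "\<not> ?thesis"
  then have small: "\<bar>y t\<bar> < k * \<epsilon>" if "0 \<le> t" for t
    using that unfolding k_def by (meson not_le)
  have y'_lower: "b / 2 \<le> y' t" if t: "0 \<le> t" "t \<le> \<epsilon>" for t
  proof -
    have "(\<epsilon> * y' 0 + y 0) + (- (B * k * \<epsilon>)) * t \<le> \<epsilon> * y' t + y t"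
    proof (rule linear_lower_bound_from_derivative)
      fix s :: real assume s: "0 \<le> s"
      show "((\<lambda>s. \<epsilon> * y' s + y s) has_real_derivative - (c s * y s)) (at s within {0..})"
        using ode[OF s] by (auto intro!: derivative_eq_intros dy dy' s simp: eq_neg_iff_add_eq_0 mult.commute)
      have "c s * y s \<le> B * (k * \<epsilon>)"
        using c[OF s] small[OF s] assms k(2)
        by (intro order_trans[OF mult_left_mono[of "y s" "k * \<epsilon>"] mult_right_mono]) auto
      then show "- (B * k * \<epsilon>) \<le> - (c s * y s)" by (simp add: mult.assoc)
    qed (fact t(1))
    moreover have "B * k * \<epsilon> * t \<le> B * k * \<epsilon> * \<epsilon>"
      using t assms k(2) by (intro mult_left_mono) auto
    ultimately have "\<epsilon> * (b - B * k * \<epsilon> - k) \<le> \<epsilon> * y' t"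
      using small[OF t(1)] init by (simp add: algebra_simps)
    then have "b - B * k * \<epsilon> - k \<le> y' t" using assms(1) by simp
    with k show ?thesis by (simp add: algebra_simps)
  qed
  \<comment> \<open>A second integration, over the whole layer up to time \<open>\<epsilon>\<close>,
    contradicts smallness there, since \<open>k\<close> is at most
    \<open>k * (1 + B * \<epsilon>) = b / 2\<close>.\<close>
  have "y 0 + b / 2 * \<epsilon> \<le> y \<epsilon>"
    using assms(1) by (intro linear_lower_bound_from_derivative[OF _ dy y'_lower]) auto
  moreover have "k * \<epsilon> \<le> b / 2 * \<epsilon>"
    unfolding k(1)[symmetric] using k(2) assms by (intro mult_right_mono) auto
  ultimately show False using small[of \<epsilon>] init assms(1) by linarith
qed

section \<open>Eigenvectors and components along them\<close>

lemma self_adjoint_symmetric: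
  assumes "self_adjoint D A" "x \<in> D" "y \<in> D"
  shows "A x \<bullet> y = x \<bullet> A y"
proof -
  have "(y, A y) \<in> adjoint_graph D A"
    using assms by (auto simp: self_adjoint_def graph_on_def)
  with assms(2) show ?thesis by (auto simp: adjoint_graph_def)
qed

lemma eigenvalue_nonneg:
  assumes "nonneg_self_adjoint D A" "eigenvector D A \<mu> x"
  shows "0 \<le> \<mu>"
proof -
  have "0 \<le> \<mu> * (x \<bullet> x)" "0 < x \<bullet> x"
    using assms by (auto simp: nonneg_self_adjoint_def eigenvector_def)
  then show ?thesis by (simp add: zero_le_mult_iff)
qed

lemma eigenvectors_orthogonal:
  assumes "self_adjoint D A" "eigenvector D A \<mu> x" "eigenvector D A \<nu> y" "\<mu> \<noteq> \<nu>"
  shows "orthogonal x y"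
proof -
  have "\<mu> * (x \<bullet> y) = \<nu> * (x \<bullet> y)"
    using self_adjoint_symmetric[OF assms(1), of x y] assms(2,3) by (auto simp: eigenvector_def)
  with assms(4) show ?thesis by (simp add: orthogonal_def)
qed

lemma C1_with_inner_left:
  assumes "C1_with f f'" "0 \<le> t"
  shows "((\<lambda>t. f t \<bullet> v) has_real_derivative f' t \<bullet> v) (at t within {0..})"
proof -
  have "(f has_vector_derivative f' t) (at t within {0..})"
    using assms by (auto simp: C1_with_def)
  from bounded_linear.has_vector_derivative[OF bounded_linear_inner_left this, of v]
  show ?thesis by (simp add: has_real_derivative_iff_has_vector_derivative)
qed

text \<open>The component along \<open>v\<close> solves a homogeneous linear equation with damping
  coefficient \<open>c * \<nu>\<close>, which is nonnegative, so its square cannot increase from its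
  initial value 0.\<close>

lemma parabolic_solution_stays_orthogonal:
  assumes A: "nonneg_self_adjoint D A" and v: "eigenvector D A \<nu> v"
    and u: "parabolic_solution D A S \<gamma> u0 u" and "orthogonal u0 v" and t: "0 \<le> t"
  shows "orthogonal (u t) v"
proof -
  obtain u' where u': "C1_with u u'" "C0_in_domain D A u" "u 0 = u0"
    and eq: "\<And>t. 0 \<le> t \<Longrightarrow> u' t + (norm (S (u t)) powr (2 * \<gamma>)) *\<^sub>R A (u t) = 0"
    using u by (auto simp: parabolic_solution_def)
  define c where "c t = norm (S (u t)) powr (2 * \<gamma>)" for t
  have u'v: "u' s \<bullet> v = - (c s * \<nu> * (u s \<bullet> v))" if s: "0 \<le> s" for s
  proof -
    have "A (u s) \<bullet> v = \<nu> * (u s \<bullet> v)"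
      using self_adjoint_symmetric[of D A "u s" v] A v u'(2) s
      by (auto simp: nonneg_self_adjoint_def C0_in_domain_def eigenvector_def)
    moreover have "u' s = - (c s *\<^sub>R A (u s))"
      using eq[OF s] by (simp add: c_def eq_neg_iff_add_eq_0)
    ultimately show ?thesis by simp
  qed
  \<comment> \<open>With \<open>m = 0\<close> the mean value bound is monotonicity; the minus signs
    turn it into an upper bound for the square.\<close>
  have "- (u 0 \<bullet> v)\<^sup>2 + 0 * t \<le> - (u t \<bullet> v)\<^sup>2"
  proof (rule linear_lower_bound_from_derivative)
    fix s :: real assume s: "0 \<le> s"
    show "((\<lambda>s. - (u s \<bullet> v)\<^sup>2) has_real_derivative 2 * (c s * \<nu>) * (u s \<bullet> v)\<^sup>2) (at s within {0..})"
      by (rule derivative_eq_intros C1_with_inner_left[OF u'(1) s] refl)+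
        (simp add: u'v[OF s] power2_eq_square)
    show "0 \<le> 2 * (c s * \<nu>) * (u s \<bullet> v)\<^sup>2"
      using eigenvalue_nonneg[OF A v] by (simp add: c_def)
  qed (fact t)
  with assms(4) u'(3) show ?thesis by (simp add: orthogonal_def)
qed

section \<open>Energy of the hyperbolic problem\<close>

lemma has_real_derivative_inner_self:
  assumes "(f has_vector_derivative f') (at t within X)"
  shows "((\<lambda>t. f t \<bullet> f t) has_real_derivative 2 * (f t \<bullet> f')) (at t within X)"
  using bounded_bilinear.has_vector_derivative[OF bounded_bilinear_inner assms assms]
  by (simp add: has_real_derivative_iff_has_vector_derivative inner_commute)

text \<open>Taking the scalar product of the equation with \<open>u'\<close> shows that the energy,
  here multiplied by \<open>\<gamma> + 1\<close>, has derivative \<open>- 2 * (\<gamma> + 1)\<close>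
  times the squared norm of \<open>u'\<close>. The potential term is a power of the squared norm
  because the latter is differentiable even at zeros of \<open>S (u t)\<close>.\<close>

lemma hyperbolic_energy_bound:
  assumes sqrt: "is_sqrt_of DS S D A" and \<gamma>: "0 < \<gamma>" and t: "0 \<le> t"
    and u: "C1_with u u'" "C1_with u' u''" "C1_in_domain_with DS S u u'" "C0_in_domain D A u"
    and eq: "\<And>t. 0 \<le> t \<Longrightarrow>
      \<epsilon> *\<^sub>R u'' t + u' t + (norm (S (u t)) powr (2 * \<gamma>)) *\<^sub>R A (u t) = 0"
  shows "(\<gamma> + 1) * \<epsilon> * (norm (u' t))\<^sup>2 + (norm (S (u t)))\<^sup>2 powr (\<gamma> + 1)
    \<le> (\<gamma> + 1) * \<epsilon> * (norm (u' 0))\<^sup>2 + (norm (S (u 0)))\<^sup>2 powr (\<gamma> + 1)"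
proof -
  define q where "q s = S (u s) \<bullet> S (u s)" for s
  define F where "F s = (\<gamma> + 1) * \<epsilon> * (u' s \<bullet> u' s) + q s powr (\<gamma> + 1)" for s
  have "- F 0 + 0 * t \<le> - F t"
  proof (rule linear_lower_bound_from_derivative)
    fix s :: real assume s: "0 \<le> s"
    have "(u' has_vector_derivative u'' s) (at s within {0..})"
      using u(2) s by (auto simp: C1_with_def)
    note du = has_real_derivative_inner_self[OF this]
    have "((\<lambda>s. (u s, S (u s))) has_vector_derivative (u' s, S (u' s))) (at s within {0..})"
      using u(3) s by (auto simp: C1_in_domain_with_def C1_with_def)
    from bounded_linear.has_vector_derivative[OF bounded_linear_snd this]
    have dS: "((\<lambda>s. S (u s)) has_vector_derivative S (u' s)) (at s within {0..})"
      by simp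
    then have dq: "(q has_real_derivative 2 * (S (u s) \<bullet> S (u' s))) (at s within {0..})"
      unfolding q_def[abs_def] by (rule has_real_derivative_inner_self)
    have "((\<lambda>x. x powr (\<gamma> + 1)) has_real_derivative (\<gamma> + 1) * q s powr \<gamma>)
        (at (q s) within q ` {0..})"
      using has_real_derivative_powr_within_nonneg[of "\<gamma> + 1" "q s"] \<gamma>
      by (auto simp: q_def intro: has_field_derivative_subset)
    from DERIV_image_chain[OF this dq]
    have dp: "((\<lambda>s. q s powr (\<gamma> + 1)) has_real_derivative
        (\<gamma> + 1) * q s powr \<gamma> * (2 * (S (u s) \<bullet> S (u' s)))) (at s within {0..})"
      by (simp add: o_def)
    \<comment> \<open>The velocity lies only in \<open>DS\<close>, so symmetry of \<open>S\<close>
      is used to move it off \<open>u' s\<close> and onto \<open>S (u s)\<close>, which is in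
      \<open>DS\<close> because \<open>u s\<close> is in \<open>D\<close>.\<close>
    have SA: "S (u s) \<bullet> S (u' s) = A (u s) \<bullet> u' s"
    proof -
      have "u s \<in> D" "u' s \<in> DS"
        using u(3,4) s by (auto simp: C0_in_domain_def C1_in_domain_with_def)
      with sqrt have "S (u s) \<in> DS" "A (u s) = S (S (u s))" "self_adjoint DS S"
        by (auto simp: is_sqrt_of_def nonneg_self_adjoint_def)
      with \<open>u' s \<in> DS\<close> show ?thesis by (simp add: self_adjoint_symmetric)
    qed
    have "q s powr \<gamma> = norm (S (u s)) powr (2 * \<gamma>)"
      by (simp add: q_def powr_powr flip: power2_norm_eq_inner powr_numeral)
    then have "u' s \<bullet> (\<epsilon> *\<^sub>R u'' s + u' s + q s powr \<gamma> *\<^sub>R A (u s)) = 0"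
      using eq[OF s] by simp
    then have dissipation: "\<epsilon> * (u' s \<bullet> u'' s) + q s powr \<gamma> * (A (u s) \<bullet> u' s) = - (u' s \<bullet> u' s)"
      by (simp add: inner_add_right inner_commute)
    have "(F has_real_derivative (\<gamma> + 1) * \<epsilon> * (2 * (u' s \<bullet> u'' s)) +
        (\<gamma> + 1) * q s powr \<gamma> * (2 * (S (u s) \<bullet> S (u' s)))) (at s within {0..})"
      unfolding F_def[abs_def] by (intro DERIV_add DERIV_cmult du dp)
    also have "(\<gamma> + 1) * \<epsilon> * (2 * (u' s \<bullet> u'' s)) +
        (\<gamma> + 1) * q s powr \<gamma> * (2 * (S (u s) \<bullet> S (u' s))) = - (2 * (\<gamma> + 1) * (u' s \<bullet> u' s))"
      using arg_cong[OF dissipation, of "\<lambda>x. 2 * (\<gamma> + 1) * x"] by (simp add: SA algebra_simps)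
    finally show "((\<lambda>s. - F s) has_real_derivative 2 * (\<gamma> + 1) * (u' s \<bullet> u' s)) (at s within {0..})"
      using DERIV_minus by fastforce
    show "0 \<le> 2 * (\<gamma> + 1) * (u' s \<bullet> u' s)" using \<gamma> by simp
  qed (fact t)
  then show ?thesis by (simp add: F_def q_def power2_norm_eq_inner)
qed

text \<open>Bridges the exponents: the energy controls the power \<open>\<gamma> + 1\<close> of the
  squared norm, while the coefficient of the equation is its power \<open>\<gamma>\<close>.\<close>

lemma powr_le_one_plus_powr:
  fixes x a b :: real
  assumes "0 \<le> x" "0 \<le> a" "a \<le> b"
  shows "x powr a \<le> 1 + x powr b"
proof (cases "x \<le> 1")
  case True
  with assms have "x powr a \<le> 1" by (simp add: powr_le1)
  then show ?thesis by (simp add: add_increasing2)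
next
  case False
  then have "x powr a \<le> x powr b" using assms by (intro powr_mono) auto
  then show ?thesis by simp
qed

section \<open>The lower bound for the difference of the two solutions\<close>

theorem theorem2p3:
  fixes A S :: "'h::{real_inner, complete_space} \<Rightarrow> 'h"
    and DA DS :: "'h set"
    and \<gamma> \<mu> \<nu> \<delta> \<epsilon>\<^sub>0 :: real
    and u0 u1 :: 'h
    and u :: "real \<Rightarrow> 'h"
    and ue :: "real \<Rightarrow> real \<Rightarrow> 'h"
    and \<rho> :: "real \<Rightarrow> real \<Rightarrow> 'h"
  assumes "separable_space (euclidean :: 'h topology)"
    and "nonneg_self_adjoint DA A"
    and "is_sqrt_of DS S DA A"
    and "\<gamma> \<ge> 1"
    and "u0 \<in> DA" and "u1 \<in> DS" and "S u0 \<noteq> 0"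
    and "\<epsilon>\<^sub>0 > 0"
    and "parabolic_solution DA A S \<gamma> u0 u"
    and "\<And>\<epsilon>. 0 < \<epsilon> \<Longrightarrow> \<epsilon> < \<epsilon>\<^sub>0 \<Longrightarrow> hyperbolic_solution DA A DS S \<gamma> u0 u1 \<epsilon> (ue \<epsilon>)"
    and "\<And>\<epsilon> t. 0 < \<epsilon> \<Longrightarrow> \<epsilon> < \<epsilon>\<^sub>0 \<Longrightarrow> 0 \<le> t \<Longrightarrow> \<rho> \<epsilon> t = ue \<epsilon> t - u t"
    and "eigenvector DA A \<mu> u0" and "eigenvector DA A \<nu> u1"
    and "\<delta> = \<nu> / \<mu>"
    and "\<nu> < \<mu> \<or> (\<nu> = \<mu> \<and> orthogonal u0 u1)"
  shows "\<exists>\<epsilon>\<^sub>1 C. 0 < \<epsilon>\<^sub>1 \<and> \<epsilon>\<^sub>1 < \<epsilon>\<^sub>0 \<and> 0 < C \<and>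
           (\<forall>\<epsilon>. 0 < \<epsilon> \<and> \<epsilon> < \<epsilon>\<^sub>1 \<longrightarrow>
              (SUP t\<in>{0..}. ereal ((1 + t) powr (\<delta> / \<gamma>) * (norm (\<rho> \<epsilon> t))\<^sup>2)) \<ge> ereal (C * \<epsilon>\<^sup>2))"
proof -
  have \<nu>: "0 \<le> \<nu>" and \<delta>: "0 \<le> \<delta> / \<gamma>"
    using eigenvalue_nonneg[OF assms(2)] assms(4,12-14) by auto
  have u1: "0 < u1 \<bullet> u1" using assms(13) by (auto simp: eigenvector_def)
  have A: "self_adjoint DA A" using assms(2) by (simp add: nonneg_self_adjoint_def)
  have "orthogonal u0 u1"
    using eigenvectors_orthogonal[OF A assms(12,13)] assms(15) by auto
  \<comment> \<open>Bounds the coefficient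
    \<open>norm (S (ue \<epsilon> t)) powr (2 * \<gamma>)\<close> for all times and all admissible
    \<epsilon>: it is 1 plus the initial energy with \<epsilon> replaced by
    \<open>\<epsilon>\<^sub>0\<close>.\<close>
  define M where "M = 1 + (\<gamma> + 1) * \<epsilon>\<^sub>0 * (norm u1)\<^sup>2 + (norm (S u0))\<^sup>2 powr (\<gamma> + 1)"
  have M: "0 \<le> M" using assms(4,8) by (auto simp: M_def intro!: add_nonneg_nonneg mult_nonneg_nonneg)
  \<comment> \<open>The constant of the initial layer for \<open>b = u1 \<bullet> u1\<close> and
    \<open>B = \<nu> * M\<close>, with \<open>\<epsilon>\<^sub>0\<close> in the denominator to make
    it independent of \<epsilon>. The division by \<open>norm u1\<close> anticipates the
    Cauchy-Schwarz inequality.\<close>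
  define k where "k = (u1 \<bullet> u1) / (2 * (1 + \<nu> * M * \<epsilon>\<^sub>0)) / norm u1"
  have "0 < 1 + \<nu> * M * \<epsilon>\<^sub>0" using \<nu> M assms(8) by (simp add: add_pos_nonneg)
  then have k: "0 < k" using u1 by (simp add: k_def)
  have lower: "\<exists>t\<ge>0. k * \<epsilon> \<le> norm (\<rho> \<epsilon> t)" if \<epsilon>: "0 < \<epsilon>" "\<epsilon> < \<epsilon>\<^sub>0" for \<epsilon>
  proof -
    define w where "w = ue \<epsilon>"
    obtain w' w'' where w: "C1_with w w'" "C1_with w' w''" "C1_in_domain_with DS S w w'"
        "C0_in_domain DA A w" "w 0 = u0" "w' 0 = u1"
      and eq: "\<And>t. 0 \<le> t \<Longrightarrow>
        \<epsilon> *\<^sub>R w'' t + w' t + (norm (S (w t)) powr (2 * \<gamma>)) *\<^sub>R A (w t) = 0"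
      using assms(10)[OF \<epsilon>] unfolding hyperbolic_solution_def w_def by blast
    define c where "c t = norm (S (w t)) powr (2 * \<gamma>)" for t
    have cM: "c t \<le> M" if t: "0 \<le> t" for t
    proof -
      have "c t = (norm (S (w t)))\<^sup>2 powr \<gamma>"
        by (simp add: c_def powr_powr flip: powr_numeral)
      also have "\<dots> \<le> 1 + (norm (S (w t)))\<^sup>2 powr (\<gamma> + 1)"
        using assms(4) by (intro powr_le_one_plus_powr) auto
      also have "(norm (S (w t)))\<^sup>2 powr (\<gamma> + 1) \<le>
          (\<gamma> + 1) * \<epsilon> * (norm u1)\<^sup>2 + (norm (S u0))\<^sup>2 powr (\<gamma> + 1)"
        \<comment> \<open>The kinetic term at time \<open>t\<close> is nonnegative and is
          dropped.\<close>
        using hyperbolic_energy_bound[OF assms(3) _ t w(1-4) eq] w(5,6) assms(4) \<epsilon>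
        by (smt (verit) mult_nonneg_nonneg zero_le_power2)
      also have "(\<gamma> + 1) * \<epsilon> * (norm u1)\<^sup>2 \<le> (\<gamma> + 1) * \<epsilon>\<^sub>0 * (norm u1)\<^sup>2"
        using \<epsilon> assms(4) by (intro mult_right_mono mult_left_mono) auto
      finally show ?thesis by (simp add: M_def)
    qed
    have "\<exists>t\<ge>0. (u1 \<bullet> u1) / (2 * (1 + (\<nu> * M) * \<epsilon>)) * \<epsilon> \<le> \<bar>w t \<bullet> u1\<bar>"
    proof (rule damped_oscillator_initial_layer)
      fix t :: real assume t: "0 \<le> t"
      show "((\<lambda>t. w t \<bullet> u1) has_real_derivative w' t \<bullet> u1) (at t within {0..})"
        "((\<lambda>t. w' t \<bullet> u1) has_real_derivative w'' t \<bullet> u1) (at t within {0..})"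
        using C1_with_inner_left w(1,2) t by blast+
      have "A (w t) \<bullet> u1 = \<nu> * (w t \<bullet> u1)"
        using self_adjoint_symmetric[OF A, of "w t" u1] w(4) t assms(13)
        by (auto simp: C0_in_domain_def eigenvector_def)
      \<comment> \<open>Projecting the equation on \<open>u1\<close> replaces \<open>A\<close> by
        its eigenvalue, which leaves a scalar oscillator with coefficient
        \<open>\<nu> * c t\<close>.\<close>
      then show "\<epsilon> * (w'' t \<bullet> u1) + w' t \<bullet> u1 + (\<nu> * c t) * (w t \<bullet> u1) = 0"
        using arg_cong[OF eq[OF t], of "\<lambda>x. x \<bullet> u1"] by (simp add: c_def inner_add_left mult.assoc mult.left_commute)
      show "0 \<le> \<nu> * c t \<and> \<nu> * c t \<le> \<nu> * M"
        using \<nu> cM[OF t] by (auto simp: c_def intro: mult_left_mono)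
    qed (use \<epsilon> u1 \<nu> M w(5,6) \<open>orthogonal u0 u1\<close> in \<open>auto simp: orthogonal_def\<close>)
    then obtain t where t: "0 \<le> t"
      and wt: "(u1 \<bullet> u1) / (2 * (1 + (\<nu> * M) * \<epsilon>)) * \<epsilon> \<le> \<bar>w t \<bullet> u1\<bar>" by auto
    have "k * \<epsilon> * norm u1 = (u1 \<bullet> u1) / (2 * (1 + \<nu> * M * \<epsilon>\<^sub>0)) * \<epsilon>"
      using u1 by (auto simp: k_def)
    also have "\<dots> \<le> (u1 \<bullet> u1) / (2 * (1 + (\<nu> * M) * \<epsilon>)) * \<epsilon>"
      using \<epsilon> \<nu> M u1
      by (intro mult_right_mono divide_left_mono mult_left_mono add_left_mono mult_pos_pos)
        (auto intro!: add_pos_nonneg)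
    \<comment> \<open>The parabolic solution is orthogonal to \<open>u1\<close>, so
      \<open>\<rho> \<epsilon> t\<close> and \<open>w t\<close> have the same component along
      it.\<close>
    also have "\<dots> \<le> \<bar>\<rho> \<epsilon> t \<bullet> u1\<bar>"
      using wt assms(11)[OF \<epsilon> t]
        parabolic_solution_stays_orthogonal[OF assms(2,13,9) \<open>orthogonal u0 u1\<close> t]
      by (simp add: w_def inner_diff_left orthogonal_def)
    also have "\<dots> \<le> norm (\<rho> \<epsilon> t) * norm u1" by (rule Cauchy_Schwarz_ineq2)
    finally have "k * \<epsilon> \<le> norm (\<rho> \<epsilon> t)" using u1 by simp
    with t show ?thesis by blast
  qed
  have "ereal (k\<^sup>2 * \<epsilon>\<^sup>2) \<le>
      (SUP t\<in>{0..}. ereal ((1 + t) powr (\<delta> / \<gamma>) * (norm (\<rho> \<epsilon> t))\<^sup>2))"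
    if \<epsilon>: "0 < \<epsilon>" "\<epsilon> < \<epsilon>\<^sub>0 / 2" for \<epsilon>
  proof -
    obtain t where t: "0 \<le> t" "k * \<epsilon> \<le> norm (\<rho> \<epsilon> t)"
      using lower[of \<epsilon>] \<epsilon> by auto
    have "k\<^sup>2 * \<epsilon>\<^sup>2 \<le> 1 * (norm (\<rho> \<epsilon> t))\<^sup>2"
      using power_mono[OF t(2), of 2] k \<epsilon> by (simp add: power_mult_distrib)
    also have "\<dots> \<le> (1 + t) powr (\<delta> / \<gamma>) * (norm (\<rho> \<epsilon> t))\<^sup>2"
      using t(1) \<delta> by (intro mult_right_mono ge_one_powr_ge_zero) auto
    finally show ?thesis using t(1) by (intro SUP_upper2[of t]) auto
  qed
  then show ?thesis
    \<comment> \<open>Halving \<open>\<epsilon>\<^sub>0\<close> gives the strict inequality required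
      of the threshold; squaring the lower bound for the norm gives the constant
      \<open>k\<^sup>2\<close>.\<close>
    using k assms(8) by (intro exI[of _ "\<epsilon>\<^sub>0 / 2"] exI[of _ "k\<^sup>2"]) auto
qed

end
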